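(* Let $(p_n)_{n\ge1}$ be a deterministic sequence in $[0,1]$ and consider the split-merge dynamics with splitting proportions $p_{n,k}=p_n$ for all $1\le k\le n$ (deterministic stratified case), with transformed empirical distributions $\tilde g_n$. Assume that, for some probability measure $H$ on $[0,1]$ with $H(\{0,1\})<1$, the following weak limit holds on $[0,1]$ as $n\to\infty$: $$\frac1n\sum_{k=1}^n\delta_{p_k}\Rightarrow H.$$ Set $\bar p=\int_0^1 t\,H(dt)$. Then $\bar p\in(0,1)$ and, for all $\alpha\in(0,\bar p)$, there is a unique $\theta=\theta(\alpha)\in\mathbb{R}$ such that $$\int_0^1\frac{te^{\theta}}{1-t+te^{\theta}}\,H(dt)=\alpha.$$ Define, for $\alpha\in(0,\bar p)$, $$I(\alpha)=\alpha\,\theta(\alpha)-\int_0^1\log\bigl(1-t+te^{\theta(\alpha)}\bigr)\,H(dt).$$ Then $I$ is continuous and decreasing on $(0,\bar p)$ and $I(\alpha)\to0$ as $\alpha\to\bar p$. Moreover, as $n\to\infty$, $$\tilde g_n\Rightarrow\tilde g\quad\text{weakly on }[0,1],$$ where $\tilde g$ is the probability measure on $[0,1]$ determined by $I$ as follows. Put $I(\bar p)=0$, $I(0)=\lim_{\alpha\to0^+}I(\alpha)\in(0,\infty]$ and $x_*=e^{-I(0)}\in[0,1)$; for $x\in[x_*,1]$ let $\alpha_I(x)$ be the unique solution $\alpha\in[0,\bar p]$ of $I(\alpha)=\log(1/x)$; then $$\tilde g([0,x])=\begin{cases}0,&x\in[0,x_*],\\ \alpha_I(x),&x\in(x_*,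1).\end{cases}$$
   Context: Given splitting proportions $(p_{n,k}:n\ge1,\ 1\le k\le n)$ in $[0,1]$, the break points of the split-merge dynamics are defined by $a_{n,0}=0$, $a_{n,n+1}=1$ for all $n\ge0$, and recursively for $n\ge1$, $$a_{n,k}=p_{n,k}\,a_{n-1,k-1}+(1-p_{n,k})\,a_{n-1,k},\qquad k=1,\dots,n.$$ The transformed empirical distributions are, for $n\ge1$, $$\tilde g_n=\frac1n\sum_{k=1}^n\delta_{\tilde a_{n,k}},\qquad \tilde a_{n,k}=a_{n,k}^{1/n},$$ where $\delta_a$ is the unit mass at $a$. Conventions: $e^{-\infty}=0$, $\log(1/0)=\infty$; "decreasing" means strictly decreasing. The values of $\tilde g([0,x])$ for $x<1$ determine the probability measure $\tilde g$, the remaining mass being at $1$.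
   Formalization: Apart from p̄∈(0,1), all conclusions are proved under the added assumption H({1})=0; if H({1})>0 the integral in θ is always at least H({1}), so no θ(α) exists for α∈(0,H({1})) and the statement fails as printed. *)

theory Defs
  imports "HOL-Probability.Probability"
begin

(* Only the indices 0 <= k <= n + 1 of level n are meaningful; beyond them the value is
   padded with 1.  Level n + 1 at k = 1, ..., n + 1 reads only meaningful indices of level n. *)
fun break_point :: "(nat \<Rightarrow> nat \<Rightarrow> real) \<Rightarrow> nat \<Rightarrow> nat \<Rightarrow> real" where
  "break_point p 0 k = (if k = 0 then 0 else 1)"
| "break_point p (Suc n) k =
     (if k = 0 then 0 else if k > Suc n then 1
      else p (Suc n) k * break_point p n (k - 1) + (1 - p (Suc n) k) * break_point p n k)"

definition transformed_break_point :: "(nat \<Rightarrow> nat \<Rightarrow> real) \<Rightarrow> nat \<Rightarrow> nat \<Rightarrow> real" where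
  "transformed_break_point p n k = root n (break_point p n k)"

(* The law of x_K for K uniform on {1..n}; repeated values are counted with multiplicity,
   see measure_empirical_measure. For n = 0 it is a junk (null) measure. *)
definition empirical_measure :: "nat \<Rightarrow> (nat \<Rightarrow> real) \<Rightarrow> real measure" where
  "empirical_measure n x = distr (uniform_count_measure {1..n}) borel x"

lemma measure_empirical_measure:
  assumes "n \<ge> 1" and A: "A \<in> sets borel"
  shows "measure (empirical_measure n x) A
           = (1 / real n) * (\<Sum>k=1..n. measure (return borel (x k)) A)"
proof -
  have "measure (empirical_measure n x) A
          = measure (uniform_count_measure {1..n}) {k \<in> {1..n}. x k \<in> A}"
    unfolding empirical_measure_def using A
    by (subst measure_distr)
       (auto simp: measurable_def space_uniform_count_measure sets_uniform_count_measure
             intro!: arg_cong[where f = "measure _"])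
  also have "\<dots> = real (card {k \<in> {1..n}. x k \<in> A}) / real n"
    by (subst measure_uniform_count_measure) auto
  also have "real (card {k \<in> {1..n}. x k \<in> A}) = (\<Sum>k=1..n. indicator A (x k))"
    by (simp add: indicator_def sum.If_cases Int_def)
  also have "\<dots> = (\<Sum>k=1..n. measure (return borel (x k)) A)"
    using A by (simp add: measure_return)
  finally show ?thesis by simp
qed

(* Probability measures on [0,1] are represented as Borel probability measures on the real
   line giving full mass to [0,1].  As [0,1] is closed in the real line, weak convergence
   on [0,1] is then weak convergence on the line (weak_conv_m). *)
definition unit_distribution :: "real measure \<Rightarrow> bool" where
  "unit_distribution H \<longleftrightarrow> real_distribution H \<and> measure H {0..1} = 1"

definition mean01 :: "real measure \<Rightarrow> real" where
  "mean01 H = (LINT t:{0..1}|H. t)"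

definition tilted_mean :: "real measure \<Rightarrow> real \<Rightarrow> real" where
  "tilted_mean H \<theta> = (LINT t:{0..1}|H. t * exp \<theta> / (1 - t + t * exp \<theta>))"

definition tilt :: "real measure \<Rightarrow> real \<Rightarrow> real" where
  "tilt H \<alpha> = (THE \<theta>. tilted_mean H \<theta> = \<alpha>)"

definition rate :: "real measure \<Rightarrow> real \<Rightarrow> real" where
  "rate H \<alpha> = \<alpha> * tilt H \<alpha> - (LINT t:{0..1}|H. ln (1 - t + t * exp (tilt H \<alpha>)))"

definition ext_rate :: "real measure \<Rightarrow> real \<Rightarrow> ereal" where
  "ext_rate H \<alpha> =
     (if \<alpha> = 0 then Lim (at_right 0) (\<lambda>a. ereal (rate H a))
      else if \<alpha> = mean01 H then 0
      else ereal (rate H \<alpha>))"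

definition exp_minus :: "ereal \<Rightarrow> real" where
  "exp_minus y = (if y = \<infinity> then 0 else exp (- real_of_ereal y))"

definition log_inverse :: "real \<Rightarrow> ereal" where
  "log_inverse x = (if x = 0 then \<infinity> else ereal (ln (1 / x)))"

definition x_star :: "real measure \<Rightarrow> real" where
  "x_star H = exp_minus (ext_rate H 0)"

definition alpha_I :: "real measure \<Rightarrow> real \<Rightarrow> real" where
  "alpha_I H x = (THE \<alpha>. \<alpha> \<in> {0..mean01 H} \<and> ext_rate H \<alpha> = log_inverse x)"

definition is_limit_law :: "real measure \<Rightarrow> real measure \<Rightarrow> bool" where
  "is_limit_law H g \<longleftrightarrow> unit_distribution g \<and>
     (\<forall>x. 0 \<le> x \<and> x < 1 \<longrightarrow> measure g {0..x} = (if x \<le> x_star H then 0 else alpha_I H x))"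

(* At t = 1 the integrand of tilted_mean is 1 for every theta, so an atom of H at 1 bounds
   the tilted mean from below: no theta solves tilted_mean H theta = alpha when
   alpha < H({1}).  Hence solvability for all alpha > 0 forces H({1}) = 0. *)
lemma tilted_mean_ge_atom:
  assumes "unit_distribution H"
  shows "measure H {1} \<le> tilted_mean H \<theta>"
proof -
  interpret real_distribution H using assms by (simp add: unit_distribution_def)
  let ?f = "\<lambda>t::real. t * exp \<theta> / (1 - t + t * exp \<theta>)"
  have bd: "0 \<le> ?f t \<and> ?f t \<le> 1" if "t \<in> {0..1}" for t
  proof -
    have "1 - t + t * exp \<theta> \<ge> 0" using that by simp
    moreover have "t * exp \<theta> \<le> 1 - t + t * exp \<theta>" using that by simp
    moreover have "t * exp \<theta> \<ge> 0" using that by simp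
    ultimately show ?thesis by (auto simp: divide_le_eq_1)
  qed
  have int: "integrable H (\<lambda>t. indicator {0..1} t *\<^sub>R ?f t)"
    by (rule integrable_const_bound[where B = 1])
       (use bd in \<open>auto simp: indicator_def abs_le_iff intro!: AE_I2 order_trans[of _ "0::real" 1]\<close>)
  have "measure H {1} = (LINT t|H. indicator {1::real} t)" by simp
  also have "\<dots> \<le> (LINT t|H. indicator {0..1} t *\<^sub>R ?f t)"
  proof (rule integral_mono[OF _ int])
    show "integrable H (indicator {1::real} :: real \<Rightarrow> real)"
      by (rule integrable_const_bound[where B = 1]) auto
    show "indicator {1} t \<le> indicator {0..1} t *\<^sub>R ?f t" for t :: real
      using bd[of t] by (auto simp: indicator_def)
  qed
  finally show ?thesis by (simp add: tilted_mean_def set_lebesgue_integral_def)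
qed

end

theory Submission
  imports Defs
begin

text \<open>
  For stratified proportions the recursion of the break points is the one that the distribution
  function of a sum of independent Bernoulli variables satisfies: if \<open>S\<^sub>n\<close> is a sum of \<open>n\<close>
  independent Bernoulli variables with parameters \<open>p\<^sub>1, \<dots>, p\<^sub>n\<close>, then \<open>P(S\<^sub>n < k)\<close> is the break
  point of index \<open>k\<close> at level \<open>n\<close> (\<open>break_point_eq_sum_success_weight\<close>).  The mass of the
  transformed empirical distribution on \<open>[0, x]\<close> is therefore the proportion of those \<open>k \<le> n\<close> for
  which \<open>P(S\<^sub>n < k) \<le> x\<^sup>n\<close>, and the theorem amounts to a large deviation estimate on the
  exponential scale, \<open>P(S\<^sub>n < \<alpha> n) = exp (- n I(\<alpha>) + o(n))\<close> for \<open>0 < \<alpha> < pbar\<close>, where \<open>pbar\<close>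
  is the mean of \<open>H\<close>.  By monotonicity in \<open>k\<close>, if \<open>exp (- I(\<alpha>)) < x\<close>, then eventually all
  \<open>k \<le> \<alpha> n\<close> are counted, and if \<open>x < exp (- I(\<alpha>))\<close>, then, for every \<open>\<delta> > 0\<close>, eventually no
  \<open>k > (\<alpha> + \<delta>) n\<close> is.  As \<open>I\<close> decreases strictly to \<open>0\<close> at \<open>pbar\<close>, for every \<open>x < 1\<close> these
  two regimes meet at a single \<open>\<alpha>\<close> in \<open>[0, pbar)\<close>.

  The upper estimate is Chernoff's bound (\<open>break_point_chernoff\<close>).  The lower one is Cramer's
  change of measure (\<open>break_point_tilting_lower_bound\<close>): the exponentially tilted weights are
  again those of a sum of independent Bernoulli variables, and Chebyshev's inequality shows that
  they concentrate near their mean, which is close to \<open>\<alpha> n\<close> for \<open>\<theta> = \<theta>(\<alpha>)\<close>.  The hypothesis on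
  the empirical distributions of the proportions enters only through averages of continuous
  functions of them (\<open>empirical_average_tendsto\<close>): the normalized logarithmic moment generating
  function of \<open>S\<^sub>n\<close> tends to \<open>\<Lambda>(\<theta>) = \<integral> log (1 - t + t exp \<theta>) H(dt)\<close>, and the normalized
  tilted mean tends to \<open>tilted_mean H \<theta>\<close>.

  All properties of \<open>I\<close> follow from the tangent inequality
  \<open>\<Lambda>(a) + tilted_mean H a * (b - a) \<le> \<Lambda>(b)\<close>, which for a point mass is Jensen's inequality for
  \<open>exp\<close>.  It yields \<open>I(\<alpha>) - I(\<beta>) \<le> (\<alpha> - \<beta>) \<theta>(\<alpha>)\<close> (\<open>rate_diff_le\<close>), and as \<open>\<theta>(\<alpha>)\<close> increases
  with \<open>\<alpha>\<close> and is negative below \<open>pbar\<close>, the function \<open>I\<close> is strictly decreasing, locally Lipschitz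
  and zero at \<open>pbar\<close>.  The absence of an atom of \<open>H\<close> at \<open>1\<close> makes the tilted mean tend to \<open>0\<close> as
  \<open>\<theta>\<close> tends to minus infinity, so that \<open>\<theta>(\<alpha>)\<close> exists for every \<open>\<alpha>\<close> in question.  The limit law
  is the law of \<open>exp (- I(U))\<close> for \<open>U\<close> uniform on \<open>(0, 1)\<close>, with the value \<open>1\<close> where \<open>U \<ge> pbar\<close>.
\<close>

section \<open>Break points as lower tails of Bernoulli sums\<close>

text \<open>The probability that exactly \<open>j\<close> of \<open>n\<close> independent trials with success probabilities
  \<open>q 1, \<dots>, q n\<close> succeed.  Working with the weights rather than with random variables turns every
  fact about the Bernoulli sum that is needed into a finite induction.\<close>

fun success_weight :: "(nat \<Rightarrow> real) \<Rightarrow> nat \<Rightarrow> nat \<Rightarrow> real" where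
  "success_weight q 0 j = (if j = 0 then 1 else 0)"
| "success_weight q (Suc n) j =
     (if j = 0 then 0 else q (Suc n) * success_weight q n (j - 1))
       + (1 - q (Suc n)) * success_weight q n j"

lemma success_weight_eq_0: "n < j \<Longrightarrow> success_weight q n j = 0"
  by (induction n arbitrary: j) auto

lemma success_weight_nonneg:
  assumes "\<And>i. i \<ge> 1 \<Longrightarrow> q i \<in> {0..1}"
  shows "0 \<le> success_weight q n j"
proof (induction n arbitrary: j)
  case (Suc n)
  then show ?case using assms[of "Suc n"] by simp
qed simp

text \<open>Conditioning on the last trial.  With \<open>f\<close> constant, exponential, linear or quadratic this is
  the induction step for total mass, moment generating function, mean and variance.\<close>

lemma sum_success_weight_Suc:
  "(\<Sum>j\<le>Suc n. success_weight q (Suc n) j * f j)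
     = q (Suc n) * (\<Sum>j\<le>n. success_weight q n j * f (Suc j))
       + (1 - q (Suc n)) * (\<Sum>j\<le>n. success_weight q n j * f j)"
proof -
  have "(\<Sum>j\<le>Suc n. success_weight q (Suc n) j * f j)
      = (\<Sum>j\<le>Suc n. (if j = 0 then 0 else q (Suc n) * success_weight q n (j - 1)) * f j)
        + (\<Sum>j\<le>Suc n. (1 - q (Suc n)) * success_weight q n j * f j)"
    by (simp only: success_weight.simps distrib_right sum.distrib)
  also have "(\<Sum>j\<le>Suc n. (if j = 0 then 0 else q (Suc n) * success_weight q n (j - 1)) * f j)
      = q (Suc n) * (\<Sum>j\<le>n. success_weight q n j * f (Suc j))"
    by (subst sum.atMost_Suc_shift) (simp add: sum_distrib_left mult.assoc)
  also have "(\<Sum>j\<le>Suc n. (1 - q (Suc n)) * success_weight q n j * f j)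
      = (1 - q (Suc n)) * (\<Sum>j\<le>n. success_weight q n j * f j)"
    by (simp add: success_weight_eq_0 sum_distrib_left mult.assoc)
  finally show ?thesis .
qed

lemma sum_success_weight: "(\<Sum>j\<le>n. success_weight q n j) = 1"
proof (induction n)
  case (Suc n)
  then show ?case using sum_success_weight_Suc[of q n "\<lambda>_. 1"] by simp
qed simp

lemma success_weight_mgf:
  "(\<Sum>j\<le>n. success_weight q n j * exp (\<theta> * real j)) = (\<Prod>i=1..n. 1 - q i + q i * exp \<theta>)"
proof (induction n)
  case (Suc n)
  have "(\<Sum>j\<le>n. success_weight q n j * exp (\<theta> * real (Suc j)))
      = exp \<theta> * (\<Sum>j\<le>n. success_weight q n j * exp (\<theta> * real j))"
    by (simp add: sum_distrib_left algebra_simps exp_add)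
  then show ?case
    using Suc by (simp only: sum_success_weight_Suc) (simp add: algebra_simps)
qed simp

lemma success_weight_mean:
  "(\<Sum>j\<le>n. success_weight q n j * (real j - (\<Sum>i=1..n. q i))) = 0"
proof (induction n)
  case (Suc n)
  let ?m = "\<Sum>i=1..n. q i"
  have *: "(\<Sum>j\<le>n. success_weight q n j * (real j - ?m + c)) = c" for c
    using Suc by (simp add: distrib_left sum.distrib sum_success_weight flip: sum_distrib_right)
  have "real (Suc j) - (\<Sum>i=1..Suc n. q i) = real j - ?m + (1 - q (Suc n))"
    "real j - (\<Sum>i=1..Suc n. q i) = real j - ?m + (- q (Suc n))" for j
    by simp_all
  then show ?case
    by (simp only: sum_success_weight_Suc *) (simp add: algebra_simps)
qed simp

lemma success_weight_variance:
  "(\<Sum>j\<le>n. success_weight q n j * (real j - (\<Sum>i=1..n. q i))\<^sup>2) = (\<Sum>i=1..n. q i * (1 - q i))"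
proof (induction n)
  case (Suc n)
  let ?m = "\<Sum>i=1..n. q i"
  have *: "(\<Sum>j\<le>n. success_weight q n j * (real j - ?m + c)\<^sup>2) = (\<Sum>i=1..n. q i * (1 - q i)) + c\<^sup>2" for c
  proof -
    have "(\<Sum>j\<le>n. success_weight q n j * (real j - ?m + c)\<^sup>2)
      = (\<Sum>j\<le>n. success_weight q n j * (real j - ?m)\<^sup>2
          + 2 * c * (success_weight q n j * (real j - ?m)) + c\<^sup>2 * success_weight q n j)"
      by (intro sum.cong) (auto simp: power2_eq_square algebra_simps)
    then show ?thesis
      using Suc by (simp add: sum.distrib success_weight_mean sum_success_weight
                         del: One_nat_def flip: sum_distrib_left)
  qed
  have "real (Suc j) - (\<Sum>i=1..Suc n. q i) = real j - ?m + (1 - q (Suc n))"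
     "real j - (\<Sum>i=1..Suc n. q i) = real j - ?m + (- q (Suc n))" for j
    by simp_all
  then show ?case
    by (simp only: sum_success_weight_Suc *) (simp add: power2_eq_square algebra_simps)
qed simp

text \<open>Weighting a product law by \<open>exp (\<theta> j)\<close> keeps the trials independent and only replaces each
  success probability by its tilted value.\<close>

lemma success_weight_tilt:
  assumes "\<And>i. i \<ge> 1 \<Longrightarrow> 1 - q i + q i * exp \<theta> \<noteq> 0"
  shows "success_weight q n j * exp (\<theta> * real j)
     = (\<Prod>i=1..n. 1 - q i + q i * exp \<theta>)
       * success_weight (\<lambda>i. q i * exp \<theta> / (1 - q i + q i * exp \<theta>)) n j"
proof (induction n arbitrary: j)
  case (Suc n)
  let ?d = "1 - q (Suc n) + q (Suc n) * exp \<theta>"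
  let ?t = "\<lambda>i. q i * exp \<theta> / (1 - q i + q i * exp \<theta>)"
  let ?Z = "\<Prod>i=1..n. 1 - q i + q i * exp \<theta>"
  have d: "?d \<noteq> 0" using assms[of "Suc n"] by simp
  have up: "?d * ?t (Suc n) = q (Suc n) * exp \<theta>" and down: "?d * (1 - ?t (Suc n)) = 1 - q (Suc n)"
    using d by (simp_all add: field_simps)
  show ?case
  proof (cases j)
    case 0
    have "success_weight q (Suc n) j * exp (\<theta> * real j) = (1 - q (Suc n)) * (?Z * success_weight ?t n 0)"
      using Suc.IH[of 0] 0 by simp
    also have "\<dots> = (?d * (1 - ?t (Suc n))) * (?Z * success_weight ?t n 0)"
      by (simp only: down)
    also have "\<dots> = (?Z * ?d) * ((1 - ?t (Suc n)) * success_weight ?t n 0)"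
      by (simp only: mult_ac)
    finally show ?thesis using 0 by simp
  next
    case (Suc i)
    have "success_weight q (Suc n) j * exp (\<theta> * real j)
       = q (Suc n) * exp \<theta> * (success_weight q n i * exp (\<theta> * real i))
         + (1 - q (Suc n)) * (success_weight q n j * exp (\<theta> * real j))"
      using Suc by (simp add: algebra_simps exp_add)
    also have "\<dots> = (?d * ?t (Suc n)) * (?Z * success_weight ?t n i)
         + (?d * (1 - ?t (Suc n))) * (?Z * success_weight ?t n j)"
      by (simp only: Suc.IH up down)
    also have "\<dots> = ?Z * ?d * (?t (Suc n) * success_weight ?t n i
         + (1 - ?t (Suc n)) * success_weight ?t n j)"
      by (simp only: distrib_left mult_ac)
    finally show ?thesis using Suc by simp
  qed
qed simp

text \<open>Conditioning on the last trial, \<open>P(S\<^bsub>n+1\<^esub> < k)\<close> is the mixture of \<open>P(S\<^sub>n < k - 1)\<close> and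
  \<open>P(S\<^sub>n < k)\<close> with weights \<open>p (n + 1)\<close> and its complement, as in the split-merge recursion.\<close>

lemma break_point_eq_sum_success_weight:
  "break_point (\<lambda>n k. p n) n k = (\<Sum>j<k. success_weight p n j)"
proof (induction n arbitrary: k)
  case 0
  show ?case by (cases k) (simp_all del: sum.lessThan_Suc add: sum.lessThan_Suc_shift)
next
  case (Suc n)
  show ?case
  proof (cases "k \<le> Suc n")
    case True
    show ?thesis
    proof (cases k)
      case (Suc m)
      have "(\<Sum>j<Suc m. success_weight p (Suc n) j)
        = p (Suc n) * (\<Sum>j<m. success_weight p n j)
            + (1 - p (Suc n)) * (\<Sum>j<Suc m. success_weight p n j)"
        by (simp only: success_weight.simps sum.distrib, subst sum.lessThan_Suc_shift)
           (simp add: distrib_left sum_distrib_left)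
      then show ?thesis using Suc Suc.IH True by (simp del: sum.lessThan_Suc)
    qed simp
  next
    case False
    then have "(\<Sum>j<k. success_weight p (Suc n) j) = (\<Sum>j\<le>Suc n. success_weight p (Suc n) j)"
      by (intro sum.mono_neutral_right) (auto simp del: success_weight.simps intro!: success_weight_eq_0)
    then show ?thesis using False by (simp only: sum_success_weight) simp
  qed
qed

section \<open>Chernoff and tilting bounds\<close>

lemma bernoulli_mgf_pos: "t \<in> {0..1} \<Longrightarrow> 0 < 1 - t + t * exp \<theta>" for t \<theta> :: real
  by (cases "t = 0") (auto intro!: add_nonneg_pos)

lemma bernoulli_tilt_range:
  "t \<in> {0..1} \<Longrightarrow> t * exp \<theta> / (1 - t + t * exp \<theta>) \<in> {0..1}" for t \<theta> :: real
  using bernoulli_mgf_pos[of t \<theta>] by auto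

lemma break_point_range:
  assumes "\<And>i. i \<ge> 1 \<Longrightarrow> p i \<in> {0..1}"
  shows "break_point (\<lambda>n k. p n) n k \<in> {0..1}"
proof -
  have "(\<Sum>j<k. success_weight p n j) = (\<Sum>j\<in>{..<k} \<inter> {..n}. success_weight p n j)"
    by (intro sum.mono_neutral_right) (auto intro!: success_weight_eq_0)
  also have "\<dots> \<le> (\<Sum>j\<le>n. success_weight p n j)"
    using success_weight_nonneg[OF assms] by (intro sum_mono2) auto
  finally show ?thesis
    using success_weight_nonneg[OF assms]
    by (auto simp: break_point_eq_sum_success_weight sum_success_weight intro!: sum_nonneg)
qed

text \<open>Markov's inequality for \<open>exp (\<theta> S\<^sub>n)\<close>: as \<open>\<theta> \<le> 0\<close>, on \<open>S\<^sub>n < k\<close> this variable is at least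
  \<open>exp (\<theta> k)\<close>.\<close>

lemma break_point_chernoff:
  assumes p: "\<And>i. i \<ge> 1 \<Longrightarrow> p i \<in> {0..1}" and "\<theta> \<le> 0"
  shows "break_point (\<lambda>n k. p n) n k
           \<le> exp (- \<theta> * real k + (\<Sum>i=1..n. ln (1 - p i + p i * exp \<theta>)))"
proof -
  note w = success_weight_nonneg[OF p]
  have "(\<Sum>j<k. success_weight p n j) = (\<Sum>j\<in>{..<k} \<inter> {..n}. success_weight p n j)"
    by (intro sum.mono_neutral_right) (auto intro!: success_weight_eq_0)
  also have "\<dots> \<le> (\<Sum>j\<in>{..<k} \<inter> {..n}. success_weight p n j * exp (\<theta> * real j) * exp (- \<theta> * real k))"
  proof (intro sum_mono)
    fix j assume j: "j \<in> {..<k} \<inter> {..n}"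
    have "1 \<le> exp (\<theta> * real j) * exp (- \<theta> * real k)"
      using j \<open>\<theta> \<le> 0\<close> by (simp add: mult_left_mono_neg flip: exp_add)
    then show "success_weight p n j \<le> success_weight p n j * exp (\<theta> * real j) * exp (- \<theta> * real k)"
      using mult_left_mono[OF _ w] by (fastforce simp: mult.assoc)
  qed
  also have "\<dots> \<le> (\<Sum>j\<le>n. success_weight p n j * exp (\<theta> * real j) * exp (- \<theta> * real k))"
    using w by (intro sum_mono2) auto
  also have "\<dots> = exp (- \<theta> * real k) * (\<Prod>i=1..n. 1 - p i + p i * exp \<theta>)"
    by (simp add: success_weight_mgf flip: sum_distrib_right)
  also have "(\<Prod>i=1..n. 1 - p i + p i * exp \<theta>) = exp (\<Sum>i=1..n. ln (1 - p i + p i * exp \<theta>))"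
    using bernoulli_mgf_pos[OF p] by (simp add: exp_sum)
  finally show ?thesis by (simp add: break_point_eq_sum_success_weight flip: exp_add)
qed

text \<open>Chebyshev's inequality, with the variance of each trial bounded by \<open>1\<close>.\<close>

lemma success_weight_chebyshev:
  assumes q: "\<And>i. i \<ge> 1 \<Longrightarrow> q i \<in> {0..1}" and "0 < r"
  shows "1 - real n / r\<^sup>2 \<le> (\<Sum>j | j \<le> n \<and> \<bar>real j - (\<Sum>i=1..n. q i)\<bar> \<le> r. success_weight q n j)"
proof -
  let ?m = "\<Sum>i=1..n. q i"
  note w = success_weight_nonneg[OF q]
  have "r\<^sup>2 * (\<Sum>j | j \<le> n \<and> \<not> \<bar>real j - ?m\<bar> \<le> r. success_weight q n j)
     = (\<Sum>j | j \<le> n \<and> \<not> \<bar>real j - ?m\<bar> \<le> r. success_weight q n j * r\<^sup>2)"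
    by (simp add: sum_distrib_left mult.commute)
  also have "\<dots> \<le> (\<Sum>j | j \<le> n \<and> \<not> \<bar>real j - ?m\<bar> \<le> r. success_weight q n j * (real j - ?m)\<^sup>2)"
    using \<open>0 < r\<close> w by (intro sum_mono mult_left_mono) (auto simp: abs_le_square_iff[symmetric])
  also have "\<dots> \<le> (\<Sum>j\<le>n. success_weight q n j * (real j - ?m)\<^sup>2)"
    using w by (intro sum_mono2) auto
  also have "\<dots> = (\<Sum>i=1..n. q i * (1 - q i))" by (rule success_weight_variance)
  also have "\<dots> \<le> (\<Sum>i=1..n. 1)"
    using q by (intro sum_mono mult_le_one) auto
  finally have "(\<Sum>j | j \<le> n \<and> \<not> \<bar>real j - ?m\<bar> \<le> r. success_weight q n j) \<le> real n / r\<^sup>2"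
    using \<open>0 < r\<close> by (simp add: field_simps)
  moreover have "(\<Sum>j\<le>n. success_weight q n j)
      = (\<Sum>j | j \<le> n \<and> \<bar>real j - ?m\<bar> \<le> r. success_weight q n j)
       + (\<Sum>j | j \<le> n \<and> \<not> \<bar>real j - ?m\<bar> \<le> r. success_weight q n j)"
    by (subst sum.union_disjoint[symmetric]) (auto intro!: sum.cong)
  ultimately show ?thesis by (simp add: sum_success_weight)
qed

text \<open>Here \<open>m n\<close> is the mean of the tilted sum.  The tilted law gives the window of radius \<open>r\<close>
  around it at least the mass of Chebyshev's inequality, and undoing the tilt multiplies
  each weight there by at least \<open>exp (- \<theta> (m n - r))\<close> times the moment generating function,
  because \<open>\<theta> \<le> 0\<close>.\<close>

lemma break_point_tilting_lower_bound:
  fixes p :: "nat \<Rightarrow> real" and \<theta> :: real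
  defines "m \<equiv> \<lambda>n. \<Sum>i=1..n. p i * exp \<theta> / (1 - p i + p i * exp \<theta>)"
  assumes p: "\<And>i. i \<ge> 1 \<Longrightarrow> p i \<in> {0..1}" and "\<theta> \<le> 0" and "0 < r" and k: "m n + r < real k"
  shows "(1 - real n / r\<^sup>2) * exp (- \<theta> * (m n - r) + (\<Sum>i=1..n. ln (1 - p i + p i * exp \<theta>)))
           \<le> break_point (\<lambda>n k. p n) n k"
proof -
  define q where "q i = p i * exp \<theta> / (1 - p i + p i * exp \<theta>)" for i
  define L where "L = (\<Sum>i=1..n. ln (1 - p i + p i * exp \<theta>))"
  define J where "J = {j. j \<le> n \<and> \<bar>real j - m n\<bar> \<le> r}"
  have q: "q i \<in> {0..1}" if "i \<ge> 1" for i
    unfolding q_def by (intro bernoulli_tilt_range p that)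
  have m: "m n = (\<Sum>i=1..n. q i)" by (simp add: m_def q_def)
  note w = success_weight_nonneg[OF p] and v = success_weight_nonneg[OF q]
  have Z: "(\<Prod>i=1..n. 1 - p i + p i * exp \<theta>) = exp L"
    using bernoulli_mgf_pos[OF p] by (simp add: exp_sum L_def)
  have "1 - p i + p i * exp \<theta> \<noteq> 0" if "i \<ge> 1" for i
    using bernoulli_mgf_pos[OF p[OF that], of \<theta>] by simp
  from success_weight_tilt[where q = p and \<theta> = \<theta> and n = n, OF this]
  have tilt: "success_weight p n j * exp (\<theta> * real j) = exp L * success_weight q n j" for j
    unfolding Z q_def by blast
  have "(1 - real n / r\<^sup>2) * exp (- \<theta> * (m n - r) + L)
      \<le> (\<Sum>j\<in>J. success_weight q n j) * exp (- \<theta> * (m n - r) + L)"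
    unfolding J_def m by (intro mult_right_mono success_weight_chebyshev q \<open>0 < r\<close>) auto
  also have "\<dots> = (\<Sum>j\<in>J. success_weight q n j * exp (- \<theta> * (m n - r) + L))"
    by (simp add: sum_distrib_right)
  also have "\<dots> \<le> (\<Sum>j\<in>J. success_weight q n j * exp (- \<theta> * real j + L))"
    using v \<open>\<theta> \<le> 0\<close> by (intro sum_mono mult_left_mono) (auto simp: J_def mult_left_mono_neg)
  also have "\<dots> = (\<Sum>j\<in>J. success_weight p n j)"
  proof (intro sum.cong refl)
    fix j
    have "success_weight q n j * exp (- \<theta> * real j + L) = exp L * success_weight q n j * exp (- \<theta> * real j)"
      unfolding exp_add by (simp only: mult_ac)
    also have "\<dots> = success_weight p n j"
      unfolding tilt[symmetric] by (simp add: exp_minus)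
    finally show "success_weight q n j * exp (- \<theta> * real j + L) = success_weight p n j" .
  qed
  also have "\<dots> \<le> (\<Sum>j<k. success_weight p n j)"
    using k w by (intro sum_mono2) (auto simp: J_def)
  finally show ?thesis by (simp add: break_point_eq_sum_success_weight L_def)
qed

section \<open>Integrals over the mixing law\<close>

lemma continuous_on_unit_bounded:
  fixes f :: "real \<Rightarrow> real"
  assumes "continuous_on {0..1} f"
  obtains B where "\<And>t. t \<in> {0..1} \<Longrightarrow> \<bar>f t\<bar> \<le> B"
proof -
  have "compact (f ` {0..1})"
    using assms by (rule compact_continuous_image) simp
  then show thesis
    using that compact_imp_bounded bounded_iff by (metis imageI real_norm_def)
qed

text \<open>The logarithmic moment generating function \<open>\<Lambda>(\<theta>)\<close> of a Bernoulli variable, averaged over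
  its parameter.  The tilted mean is its derivative, and the rate function is its Legendre
  transform.\<close>
definition cumulant :: "real measure \<Rightarrow> real \<Rightarrow> real" where
  "cumulant H \<theta> = (LINT t:{0..1}|H. ln (1 - t + t * exp \<theta>))"

locale mixing_distribution = real_distribution H for H :: "real measure" +
  assumes full_mass: "measure H {0..1} = 1"
    and nondegenerate: "measure H {0, 1} < 1"
begin

lemma AE_unit: "AE t in H. t \<in> {0..1}"
  using full_mass by (subst (asm) prob_eq_1) auto

lemma interior_mass: "0 < measure H {0<..<1}"
proof -
  have "measure H {0..1} = measure H ({0, 1} \<union> {0<..<1})"
    by (intro arg_cong[where f = "measure H"]) auto
  also have "\<dots> = measure H {0, 1} + measure H {0<..<1}"
    by (intro finite_measure_Union) auto
  finally show ?thesis using full_mass nondegenerate by simp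
qed

lemma set_integrable_continuous:
  fixes f :: "real \<Rightarrow> real"
  assumes "continuous_on {0..1} f"
  shows "set_integrable H {0..1} f"
proof -
  obtain B where "\<And>t. t \<in> {0..1} \<Longrightarrow> \<bar>f t\<bar> \<le> B"
    using continuous_on_unit_bounded[OF assms] by blast
  then have "norm (indicator {0..1} t *\<^sub>R f t) \<le> \<bar>B\<bar>" for t :: real
    by (cases "t \<in> {0..1}") force+
  moreover have "(\<lambda>t. indicator {0..1} t *\<^sub>R f t) \<in> borel_measurable H"
    using borel_measurable_continuous_on_indicator[OF _ assms] by simp
  ultimately show ?thesis
    unfolding set_integrable_def by (intro integrable_const_bound[where B = "\<bar>B\<bar>"]) auto
qed

text \<open>Strictness is asked for on the open interval only, because integrands such as those of the
  tilted mean agree at the endpoints for all \<open>\<theta>\<close>; the open interval has positive mass by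
  nondegeneracy.\<close>

lemma set_integral_strict_mono:
  fixes f g :: "real \<Rightarrow> real"
  assumes "continuous_on {0..1} f" "continuous_on {0..1} g"
    and "\<And>t. t \<in> {0..1} \<Longrightarrow> f t \<le> g t" and "\<And>t. t \<in> {0<..<1} \<Longrightarrow> f t < g t"
  shows "(LINT t:{0..1}|H. f t) < (LINT t:{0..1}|H. g t)"
  unfolding set_lebesgue_integral_def
proof (rule integral_less_AE[where A = "{0<..<1}"])
  show "emeasure H {0<..<1} \<noteq> 0"
    using interior_mass by (simp add: emeasure_eq_measure)
  show "AE t in H. t \<in> {0<..<1} \<longrightarrow> indicator {0..1} t *\<^sub>R f t \<noteq> indicator {0..1} t *\<^sub>R g t"
    using assms(4) by (intro AE_I2) (force simp: indicator_def)
  show "AE t in H. indicator {0..1} t *\<^sub>R f t \<le> indicator {0..1} t *\<^sub>R g t"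
    using assms(3) by (intro AE_I2) (auto simp: indicator_def)
qed (use assms(1,2)[THEN set_integrable_continuous] in \<open>simp_all add: set_integrable_def\<close>)

lemma set_integral_const: "(LINT t:{0..1}|H. c) = (c::real)"
  using full_mass by (simp add: set_lebesgue_integral_def)

lemma mean01_bounds: "0 < mean01 H" "mean01 H < 1"
  using set_integral_strict_mono[of "\<lambda>_. 0" "\<lambda>t. t"] set_integral_strict_mono[of "\<lambda>t. t" "\<lambda>_. 1"]
  by (simp_all add: mean01_def set_integral_const continuous_intros)

lemma continuous_on_tilt_integrand: "continuous_on {0..1} (\<lambda>t::real. t * exp \<theta> / (1 - t + t * exp \<theta>))"
  using bernoulli_mgf_pos by (intro continuous_intros) (metis less_irrefl)

lemma continuous_on_cumulant_integrand: "continuous_on {0..1} (\<lambda>t::real. ln (1 - t + t * exp \<theta>))"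
  using bernoulli_mgf_pos by (intro continuous_intros) (metis less_irrefl)

lemmas integrable_tilt = set_integrable_continuous[OF continuous_on_tilt_integrand]
lemmas integrable_cumulant = set_integrable_continuous[OF continuous_on_cumulant_integrand]

lemma tilted_mean_strict_mono: "a < b \<Longrightarrow> tilted_mean H a < tilted_mean H b"
proof -
  assume "a < b"
  \<comment> \<open>In this form \<open>\<theta>\<close> occurs only once, so monotonicity can be read off.\<close>
  have eq: "t * exp \<theta> / (1 - t + t * exp \<theta>) = 1 - (1 - t) / (1 - t + t * exp \<theta>)"
    if "t \<in> {0..1}" for t \<theta> :: real
    using bernoulli_mgf_pos[OF that, of \<theta>] by (simp add: field_simps)
  have *: "t * exp a / (1 - t + t * exp a) \<le> t * exp b / (1 - t + t * exp b)" if "t \<in> {0..1}" for t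
    unfolding eq[OF that] using bernoulli_mgf_pos[OF that] that \<open>a < b\<close>
    by (intro diff_left_mono divide_left_mono) (auto intro!: mult_left_mono)
  have "t * exp a / (1 - t + t * exp a) < t * exp b / (1 - t + t * exp b)" if t: "t \<in> {0<..<1}" for t
  proof -
    from t have t': "t \<in> {0..1}" by auto
    show ?thesis
      unfolding eq[OF t'] using bernoulli_mgf_pos[OF t'] t \<open>a < b\<close>
      by (intro diff_strict_left_mono divide_strict_left_mono) auto
  qed
  then show ?thesis
    unfolding tilted_mean_def using *
    by (intro set_integral_strict_mono continuous_on_tilt_integrand) auto
qed

lemma tilted_mean_less_iff: "tilted_mean H a < tilted_mean H b \<longleftrightarrow> a < b"
  using tilted_mean_strict_mono by (metis less_asym linorder_neqE_linordered_idom)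

lemma tilted_mean_0: "tilted_mean H 0 = mean01 H"
  by (simp add: tilted_mean_def mean01_def)

lemma cumulant_0: "cumulant H 0 = 0"
  by (simp add: cumulant_def)

text \<open>Dominated convergence with dominating function \<open>1\<close>.  It serves twice: for continuity in
  \<open>\<theta>\<close>, and for the limit as \<open>\<theta>\<close> tends to minus infinity.\<close>

lemma tilted_mean_sequentially:
  assumes "AE t in H. t \<in> {0..1} \<longrightarrow> (\<lambda>i. t * exp (\<theta> i) / (1 - t + t * exp (\<theta> i))) \<longlonglongrightarrow> f t"
    and "continuous_on {0..1} f"
  shows "(\<lambda>i. tilted_mean H (\<theta> i)) \<longlonglongrightarrow> (LINT t:{0..1}|H. f t)"
  unfolding tilted_mean_def set_lebesgue_integral_def
proof (rule integral_dominated_convergence[where w = "\<lambda>_. 1"])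
  show "AE t in H. (\<lambda>i. indicator {0..1} t *\<^sub>R (t * exp (\<theta> i) / (1 - t + t * exp (\<theta> i))))
      \<longlonglongrightarrow> indicator {0..1} t *\<^sub>R f t"
    using assms(1) by (rule AE_mp) (intro AE_I2, auto simp: indicator_def)
  show "AE t in H. norm (indicator {0..1} t *\<^sub>R (t * exp (\<theta> i) / (1 - t + t * exp (\<theta> i)))) \<le> 1" for i
    using bernoulli_tilt_range by (intro AE_I2) (auto simp: indicator_def)
qed (use integrable_tilt set_integrable_continuous[OF assms(2)] in \<open>auto simp: set_integrable_def\<close>)

lemma isCont_tilted_mean: "isCont (tilted_mean H) \<theta>"
  unfolding continuous_at_sequentially comp_def
proof (intro allI impI)
  fix x assume x: "x \<longlonglongrightarrow> \<theta>"
  have "(\<lambda>i. t * exp (x i) / (1 - t + t * exp (x i))) \<longlonglongrightarrow> t * exp \<theta> / (1 - t + t * exp \<theta>)"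
    if "t \<in> {0..1}" for t
    using bernoulli_mgf_pos[OF that, of \<theta>] x by (intro tendsto_intros) auto
  then show "(\<lambda>i. tilted_mean H (x i)) \<longlonglongrightarrow> tilted_mean H \<theta>"
    unfolding tilted_mean_def[of H \<theta>]
    by (intro tilted_mean_sequentially continuous_on_tilt_integrand AE_I2 impI)
qed

text \<open>The graph of the convex function \<open>cumulant H\<close> lies above its tangent at \<open>a\<close>.  It is enough
  to see this for each \<open>t\<close> separately and to integrate.  For fixed \<open>t\<close>, with the tilted
  probability \<open>q\<close>, the claim reads \<open>exp (q (b - a)) \<le> 1 - q + q exp (b - a)\<close>.\<close>

lemma cumulant_tangent: "cumulant H a + tilted_mean H a * (b - a) \<le> cumulant H b"
proof -
  have tangent: "ln (1 - t + t * exp a) + t * exp a / (1 - t + t * exp a) * (b - a)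
      \<le> ln (1 - t + t * exp b)" if t: "t \<in> {0..1}" for t
  proof -
    define D q where "D = 1 - t + t * exp a" and "q = t * exp a / D"
    have D: "0 < D" unfolding D_def by (rule bernoulli_mgf_pos[OF t])
    have q: "q \<in> {0..1}" unfolding q_def D_def by (rule bernoulli_tilt_range[OF t])
    have "exp ((1 - q) *\<^sub>R 0 + q *\<^sub>R (b - a)) \<le> (1 - q) * exp 0 + q * exp (b - a)"
      by (rule convex_onD[OF exp_convex]) (use q in auto)
    also have "\<dots> = (1 - t + t * exp b) / D"
    proof -
      have "D * q = t * exp a" using D by (simp add: q_def)
      moreover have "((1 - q) * exp 0 + q * exp (b - a)) * D = D - D * q + D * q * exp (b - a)"
        by (simp add: algebra_simps)
      ultimately have "((1 - q) * exp 0 + q * exp (b - a)) * D = 1 - t + t * exp b"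
        by (simp add: D_def mult.assoc flip: exp_add)
      then show ?thesis using D by (simp add: eq_divide_eq)
    qed
    finally have "q * (b - a) \<le> ln ((1 - t + t * exp b) / D)"
      using D bernoulli_mgf_pos[OF t, of b] by (subst ln_ge_iff) auto
    then show ?thesis
      using D bernoulli_mgf_pos[OF t, of b] by (simp add: ln_div D_def q_def)
  qed
  have i: "set_integrable H {0..1} (\<lambda>t. t * exp a / (1 - t + t * exp a) * (b - a))"
    using integrable_tilt by (rule set_integrable_mult_left)
  have "cumulant H a + tilted_mean H a * (b - a)
      = (LINT t:{0..1}|H. ln (1 - t + t * exp a) + t * exp a / (1 - t + t * exp a) * (b - a))"
    unfolding cumulant_def tilted_mean_def
    by (simp only: set_integral_add(2)[OF integrable_cumulant i] set_integral_mult_left)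
  also have "\<dots> \<le> cumulant H b"
    unfolding cumulant_def
    by (intro set_integral_mono set_integral_add(1) integrable_cumulant i tangent)
  finally show ?thesis .
qed

end

section \<open>The rate function\<close>

locale atomless_at_1_mixing_distribution = mixing_distribution +
  assumes no_atom_at_1: "measure H {1} = 0"
begin

abbreviation "pbar \<equiv> mean01 H"

text \<open>The integrand tends to \<open>0\<close> for every \<open>t < 1\<close> but equals \<open>1\<close> at \<open>t = 1\<close>, which is why an
  atom there has to be excluded.\<close>

lemma tilted_mean_tendsto_0: "(\<lambda>i. tilted_mean H (- real i)) \<longlonglongrightarrow> 0"
proof -
  have lim: "(\<lambda>i. exp (- real i)) \<longlonglongrightarrow> 0"
    by real_asymp
  have "AE t in H. t \<noteq> 1"
    using no_atom_at_1 by (intro AE_I'[of "{1}"]) (auto simp: null_sets_def emeasure_eq_measure)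
  then have "AE t in H. t \<in> {0..1} \<longrightarrow>
      (\<lambda>i. t * exp (- real i) / (1 - t + t * exp (- real i))) \<longlonglongrightarrow> 0"
  proof (rule AE_mp, intro AE_I2 impI)
    fix t :: real assume t: "t \<noteq> 1" "t \<in> {0..1}"
    have "(\<lambda>i. t * exp (- real i) / (1 - t + t * exp (- real i))) \<longlonglongrightarrow> t * 0 / (1 - t + t * 0)"
      by (intro tendsto_intros lim) (use t in auto)
    then show "(\<lambda>i. t * exp (- real i) / (1 - t + t * exp (- real i))) \<longlonglongrightarrow> 0" by simp
  qed
  from tilted_mean_sequentially[OF this] show ?thesis
    by (simp add: set_integral_const)
qed

lemma tilt_exists_unique:
  assumes "\<alpha> \<in> {0<..pbar}"
  shows "\<exists>!\<theta>. tilted_mean H \<theta> = \<alpha>"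
proof -
  have "eventually (\<lambda>i. tilted_mean H (- real i) < \<alpha>) sequentially"
    using order_tendstoD(2)[OF tilted_mean_tendsto_0, of \<alpha>] assms by simp
  then obtain i where "tilted_mean H (- real i) < \<alpha>"
    using eventually_happens by fastforce
  moreover have "continuous_on {- real i..0} (tilted_mean H)"
    by (intro continuous_at_imp_continuous_on ballI isCont_tilted_mean)
  ultimately have "\<exists>\<theta>\<ge>- real i. \<theta> \<le> 0 \<and> tilted_mean H \<theta> = \<alpha>"
    using assms by (intro IVT') (auto simp: tilted_mean_0)
  then show ?thesis
    using tilted_mean_less_iff by (metis less_irrefl linorder_neqE_linordered_idom)
qed

lemma tilted_mean_tilt: "\<alpha> \<in> {0<..pbar} \<Longrightarrow> tilted_mean H (tilt H \<alpha>) = \<alpha>"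
  unfolding tilt_def by (rule theI'[OF tilt_exists_unique])

lemma tilt_strict_mono: "\<alpha> \<in> {0<..pbar} \<Longrightarrow> \<beta> \<in> {0<..pbar} \<Longrightarrow> \<alpha> < \<beta> \<Longrightarrow> tilt H \<alpha> < tilt H \<beta>"
  using tilted_mean_tilt[of \<alpha>] tilted_mean_tilt[of \<beta>]
    tilted_mean_less_iff[of "tilt H \<alpha>" "tilt H \<beta>"] by simp

lemma tilt_pbar: "tilt H pbar = 0"
proof -
  have "pbar \<in> {0<..pbar}" using mean01_bounds by simp
  from tilted_mean_tilt[OF this] tilt_exists_unique[OF this] tilted_mean_0 show ?thesis by auto
qed

lemma tilt_neg: "\<alpha> \<in> {0<..<pbar} \<Longrightarrow> tilt H \<alpha> < 0"
  using tilt_strict_mono[of \<alpha> pbar] mean01_bounds by (simp add: tilt_pbar)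

lemma rate_eq: "rate H \<alpha> = \<alpha> * tilt H \<alpha> - cumulant H (tilt H \<alpha>)"
  by (simp add: rate_def cumulant_def)

text \<open>By the tangent inequality at \<open>\<theta>(\<beta>)\<close>, the number \<open>rate H \<beta>\<close> is at least
  \<open>\<beta> \<theta> - cumulant H \<theta>\<close> for every \<open>\<theta>\<close>.  The bound is the case \<open>\<theta> = \<theta>(\<alpha>)\<close>.\<close>

lemma rate_diff_le:
  assumes "\<beta> \<in> {0<..pbar}"
  shows "rate H \<alpha> - rate H \<beta> \<le> (\<alpha> - \<beta>) * tilt H \<alpha>"
  using cumulant_tangent[of "tilt H \<beta>" "tilt H \<alpha>"] tilted_mean_tilt[OF assms]
  by (simp add: rate_eq algebra_simps)

lemma rate_pbar: "rate H pbar = 0"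
  by (simp add: rate_eq tilt_pbar cumulant_0)

lemma rate_strict_antimono:
  assumes "\<alpha> \<in> {0<..pbar}" "\<beta> \<in> {0<..pbar}" "\<alpha> < \<beta>"
  shows "rate H \<beta> < rate H \<alpha>"
proof -
  have le: "rate H \<gamma> \<le> rate H \<delta> + (\<gamma> - \<delta>) * tilt H \<gamma>" if "\<delta> \<in> {0<..pbar}" for \<gamma> \<delta>
    using rate_diff_le[OF that, of \<gamma>] by simp
  \<comment> \<open>\<open>rate_diff_le\<close> is not strict when \<open>\<beta>\<close> is the mean, where the tilt vanishes; passing
     through the midpoint, where the tilt is negative, gives strictness.\<close>
  define \<gamma> where "\<gamma> = (\<alpha> + \<beta>) / 2"
  have \<gamma>: "\<gamma> \<in> {0<..<pbar}" "\<alpha> < \<gamma>" "\<gamma> < \<beta>"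
    using assms by (auto simp: \<gamma>_def field_simps)
  have "tilt H \<beta> \<le> 0"
    using tilt_neg[of \<beta>] tilt_pbar assms by (cases "\<beta> = pbar") auto
  then have "(\<beta> - \<gamma>) * tilt H \<beta> \<le> 0"
    using \<gamma> by (simp add: mult_nonneg_nonpos)
  moreover have "(\<gamma> - \<alpha>) * tilt H \<gamma> < 0"
    using \<gamma> tilt_neg by (simp add: mult_pos_neg)
  ultimately show ?thesis
    using le[of \<gamma> \<beta>] le[of \<alpha> \<gamma>] \<gamma> assms by simp
qed

text \<open>By \<open>rate_diff_le\<close> the slopes of the rate function are bounded in absolute value by that of
  the tilt at their left endpoint, and on \<open>{c..pbar}\<close> the tilt is most negative at \<open>c\<close>.\<close>

lemma rate_lipschitz:
  assumes "c \<in> {0<..pbar}"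
  shows "(- tilt H c)-lipschitz_on {c..pbar} (rate H)"
proof (rule lipschitz_onI)
  have *: "\<bar>rate H \<alpha> - rate H \<beta>\<bar> \<le> - tilt H c * (\<beta> - \<alpha>)"
    if "c \<le> \<alpha>" "\<alpha> < \<beta>" "\<beta> \<le> pbar" for \<alpha> \<beta>
  proof -
    have "tilt H c \<le> tilt H \<alpha>"
      using tilt_strict_mono[of c \<alpha>] that assms by (cases "c = \<alpha>") auto
    then have "tilt H c * (\<beta> - \<alpha>) \<le> tilt H \<alpha> * (\<beta> - \<alpha>)"
      using that by (intro mult_right_mono) auto
    then show ?thesis
      using rate_diff_le[of \<beta> \<alpha>] rate_strict_antimono[of \<alpha> \<beta>] that assms by (simp add: algebra_simps)
  qed
  show "0 \<le> - tilt H c"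
    using tilt_neg[of c] tilt_pbar assms by (cases "c = pbar") auto
  fix \<alpha> \<beta> assume "\<alpha> \<in> {c..pbar}" "\<beta> \<in> {c..pbar}"
  then show "dist (rate H \<alpha>) (rate H \<beta>) \<le> - tilt H c * dist \<alpha> \<beta>"
    using *[of \<alpha> \<beta>] *[of \<beta> \<alpha>] by (cases \<alpha> \<beta> rule: linorder_cases) (auto simp: dist_real_def abs_minus_commute)
qed

lemma continuous_on_rate: "continuous_on {0<..pbar} (rate H)"
  unfolding continuous_on_eq_continuous_within
proof
  fix x assume x: "x \<in> {0<..pbar}"
  then have "continuous_on {x / 2..pbar} (rate H)"
    using rate_lipschitz[of "x / 2"] by (auto intro: lipschitz_on_continuous_on)
  then have "continuous (at x within {x / 2..pbar}) (rate H)"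
    using x by (simp add: continuous_on_eq_continuous_within)
  moreover have "at x within {x / 2..pbar} = at x within {0<..pbar}"
    by (rule at_within_nhd[of _ "{x / 2<..}"]) (use x in auto)
  ultimately show "continuous (at x within {0<..pbar}) (rate H)" by simp
qed

lemma rate_tendsto_0: "(rate H \<longlongrightarrow> 0) (at_left pbar)"
proof -
  have "continuous_on {pbar / 2..pbar} (rate H)"
    using mean01_bounds by (intro continuous_on_subset[OF continuous_on_rate]) auto
  then show ?thesis
    using continuous_on_Icc_at_leftD[of "pbar / 2" pbar "rate H"] mean01_bounds by (simp add: rate_pbar)
qed

text \<open>A decreasing function tends at the left end of its domain to its supremum, here possibly
  infinite.\<close>

lemma rate_tendsto_SUP:
  "((\<lambda>\<alpha>. ereal (rate H \<alpha>)) \<longlongrightarrow> (SUP \<alpha>\<in>{0<..<pbar}. ereal (rate H \<alpha>))) (at_right 0)"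
proof (rule order_tendstoI)
  fix y assume "y < (SUP \<alpha>\<in>{0<..<pbar}. ereal (rate H \<alpha>))"
  then obtain \<alpha> where \<alpha>: "\<alpha> \<in> {0<..<pbar}" "y < ereal (rate H \<alpha>)"
    by (auto simp: less_SUP_iff)
  show "\<forall>\<^sub>F \<beta> in at_right 0. y < ereal (rate H \<beta>)"
    unfolding eventually_at_right_field
  proof (intro exI conjI allI impI)
    fix \<beta> assume "0 < \<beta>" "\<beta> < \<alpha>"
    then have "rate H \<alpha> < rate H \<beta>" using \<alpha> by (intro rate_strict_antimono) auto
    then show "y < ereal (rate H \<beta>)" using \<alpha>(2) by (meson less_ereal.simps(1) less_trans)
  qed (use \<alpha> in auto)
next
  fix y assume y: "(SUP \<alpha>\<in>{0<..<pbar}. ereal (rate H \<alpha>)) < y"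
  show "\<forall>\<^sub>F \<beta> in at_right 0. ereal (rate H \<beta>) < y"
    unfolding eventually_at_right_field
  proof (intro exI conjI allI impI)
    fix \<beta> assume "0 < \<beta>" "\<beta> < pbar"
    then have "ereal (rate H \<beta>) \<le> (SUP \<alpha>\<in>{0<..<pbar}. ereal (rate H \<alpha>))"
      by (intro SUP_upper) auto
    then show "ereal (rate H \<beta>) < y" using y by (rule le_less_trans)
  qed (use mean01_bounds in auto)
qed

lemma ext_rate_0: "ext_rate H 0 = (SUP \<alpha>\<in>{0<..<pbar}. ereal (rate H \<alpha>))"
  using rate_tendsto_SUP by (simp add: ext_rate_def tendsto_Lim)

lemma ext_rate_eq_rate: "\<alpha> \<in> {0<..pbar} \<Longrightarrow> ext_rate H \<alpha> = ereal (rate H \<alpha>)"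
  by (auto simp: ext_rate_def rate_pbar)

lemma ext_rate_strict_antimono:
  assumes "\<alpha> \<in> {0..pbar}" "\<beta> \<in> {0..pbar}" "\<alpha> < \<beta>"
  shows "ext_rate H \<beta> < ext_rate H \<alpha>"
proof (cases "\<alpha> = 0")
  case True
  have "ext_rate H \<beta> = ereal (rate H \<beta>)" using assms by (intro ext_rate_eq_rate) auto
  also have "\<dots> < ereal (rate H (\<beta> / 2))" using assms by (auto intro!: rate_strict_antimono)
  also have "\<dots> \<le> ext_rate H 0" unfolding ext_rate_0 using assms by (intro SUP_upper) auto
  finally show ?thesis by (simp add: True)
next
  case False
  then show ?thesis using assms by (simp add: ext_rate_eq_rate rate_strict_antimono)
qed

lemma ext_rate_0_pos: "0 < ext_rate H 0"
  using ext_rate_strict_antimono[of 0 pbar] mean01_bounds by (simp add: ext_rate_def)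

lemma ext_rate_ex1:
  assumes "0 \<le> y" "y \<le> ext_rate H 0"
  shows "\<exists>!\<alpha>. \<alpha> \<in> {0..pbar} \<and> ext_rate H \<alpha> = y"
proof -
  have "\<exists>\<alpha>. \<alpha> \<in> {0..pbar} \<and> ext_rate H \<alpha> = y"
  proof (cases "y = ext_rate H 0")
    case True
    then show ?thesis using mean01_bounds by (intro exI[of _ 0]) auto
  next
    case False
    then have "y < (SUP \<alpha>\<in>{0<..<pbar}. ereal (rate H \<alpha>))"
      using assms by (simp add: ext_rate_0)
    then obtain a where a: "a \<in> {0<..<pbar}" "y < ereal (rate H a)"
      by (auto simp: less_SUP_iff)
    obtain r where r: "y = ereal r"
      using a(2) assms(1) by (cases y) auto
    have "\<exists>\<alpha>\<ge>a. \<alpha> \<le> pbar \<and> rate H \<alpha> = r"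
    proof (rule IVT2')
      show "continuous_on {a..pbar} (rate H)"
        using a by (intro continuous_on_subset[OF continuous_on_rate]) auto
    qed (use a assms r in \<open>auto simp: rate_pbar\<close>)
    then obtain \<alpha> where "a \<le> \<alpha>" "\<alpha> \<le> pbar" "rate H \<alpha> = r" by blast
    then show ?thesis using a r by (intro exI[of _ \<alpha>]) (auto simp: ext_rate_eq_rate)
  qed
  moreover have "\<alpha> = \<beta>"
    if "\<alpha> \<in> {0..pbar}" "\<beta> \<in> {0..pbar}" "ext_rate H \<alpha> = ext_rate H \<beta>" for \<alpha> \<beta>
    using ext_rate_strict_antimono[of \<alpha> \<beta>] ext_rate_strict_antimono[of \<beta> \<alpha>] that
    by (cases \<alpha> \<beta> rule: linorder_cases) auto
  ultimately show ?thesis by metis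
qed

section \<open>The limit law\<close>

lemma x_star_range: "x_star H \<in> {0..<1}"
  using ext_rate_0_pos by (cases "ext_rate H 0") (auto simp: x_star_def exp_minus_def)

lemma alpha_I_ex1:
  assumes "x \<in> {x_star H..1}"
  shows "\<exists>!\<alpha>. \<alpha> \<in> {0..pbar} \<and> ext_rate H \<alpha> = log_inverse x"
proof (rule ext_rate_ex1)
  have x: "0 \<le> x" "x \<le> 1" using assms x_star_range by auto
  show "0 \<le> log_inverse x" using x by (auto simp: log_inverse_def)
  show "log_inverse x \<le> ext_rate H 0"
  proof (cases "ext_rate H 0")
    case (real r)
    then have "exp (- r) \<le> x" using assms by (simp add: x_star_def exp_minus_def)
    moreover from this have "0 < x" by (rule less_le_trans[OF exp_gt_zero])
    ultimately have "- r \<le> ln x" by (simp add: ln_ge_iff)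
    then show ?thesis using \<open>0 < x\<close> real by (simp add: log_inverse_def ln_div)
  qed (use ext_rate_0_pos in auto)
qed

definition limit_cdf :: "real \<Rightarrow> real" where
  "limit_cdf x = (if x \<le> x_star H then 0 else alpha_I H x)"

text \<open>The form in which the limit law meets the large deviation estimates: \<open>limit_cdf x\<close> separates
  the \<open>\<alpha>\<close> with \<open>exp (- rate H \<alpha>) < x\<close> from those with \<open>exp (- rate H \<alpha>) > x\<close>.  This covers both
  sides of \<open>x_star H\<close>: below it the first class is empty, as \<open>rate H\<close> stays below its limit at
  \<open>0\<close>.\<close>

lemma
  assumes "0 \<le> x" "x < 1"
  shows limit_cdf_range: "limit_cdf x \<in> {0..<pbar}"
    and less_limit_cdfD: "\<And>\<alpha>. \<alpha> \<in> {0<..<pbar} \<Longrightarrow> \<alpha> < limit_cdf x \<Longrightarrow> exp (- rate H \<alpha>) < x"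
    and limit_cdf_lessD: "\<And>\<alpha>. \<alpha> \<in> {0<..<pbar} \<Longrightarrow> limit_cdf x < \<alpha> \<Longrightarrow> x < exp (- rate H \<alpha>)"
proof -
  have "limit_cdf x \<in> {0..<pbar} \<and> (\<forall>\<alpha>\<in>{0<..<pbar}.
      (\<alpha> < limit_cdf x \<longrightarrow> exp (- rate H \<alpha>) < x) \<and> (limit_cdf x < \<alpha> \<longrightarrow> x < exp (- rate H \<alpha>)))"
  proof (cases "x \<le> x_star H")
    case True
    have "x < exp (- rate H \<alpha>)" if "\<alpha> \<in> {0<..<pbar}" for \<alpha>
    proof -
      have "ereal (rate H \<alpha>) < ext_rate H 0"
        using ext_rate_strict_antimono[of 0 \<alpha>] that by (simp add: ext_rate_eq_rate)
      then have "x_star H < exp (- rate H \<alpha>)"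
        by (cases "ext_rate H 0") (auto simp: x_star_def exp_minus_def)
      then show ?thesis using True by simp
    qed
    then show ?thesis using True mean01_bounds by (auto simp: limit_cdf_def)
  next
    case False
    then have x: "0 < x" "x \<in> {x_star H..1}" using assms x_star_range by auto
    have A: "limit_cdf x \<in> {0..pbar}" "ext_rate H (limit_cdf x) = ereal (- ln x)"
      using theI'[OF alpha_I_ex1[OF x(2)]] False x
      by (auto simp: limit_cdf_def alpha_I_def log_inverse_def ln_div)
    then have "limit_cdf x \<noteq> pbar"
      using assms x by (auto simp: ext_rate_eq_rate rate_pbar mean01_bounds)
    with A(1) have A': "limit_cdf x \<in> {0..<pbar}" by auto
    have "exp (- rate H \<alpha>) < x" if "\<alpha> \<in> {0<..<pbar}" "\<alpha> < limit_cdf x" for \<alpha>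
    proof -
      have "- ln x < rate H \<alpha>"
        using ext_rate_strict_antimono[of \<alpha> "limit_cdf x"] A that by (simp add: ext_rate_eq_rate)
      then have "- rate H \<alpha> < ln x" by simp
      then show ?thesis using x(1) by (metis exp_less_mono exp_ln)
    qed
    moreover have "x < exp (- rate H \<alpha>)" if "\<alpha> \<in> {0<..<pbar}" "limit_cdf x < \<alpha>" for \<alpha>
    proof -
      have "rate H \<alpha> < - ln x"
        using ext_rate_strict_antimono[of "limit_cdf x" \<alpha>] A that by (simp add: ext_rate_eq_rate)
      then have "ln x < - rate H \<alpha>" by simp
      then show ?thesis using x(1) by (metis exp_less_mono exp_ln)
    qed
    ultimately show ?thesis using A' by blast
  qed
  then show "limit_cdf x \<in> {0..<pbar}"
    "\<And>\<alpha>. \<alpha> \<in> {0<..<pbar} \<Longrightarrow> \<alpha> < limit_cdf x \<Longrightarrow> exp (- rate H \<alpha>) < x"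
    "\<And>\<alpha>. \<alpha> \<in> {0<..<pbar} \<Longrightarrow> limit_cdf x < \<alpha> \<Longrightarrow> x < exp (- rate H \<alpha>)"
    by blast+
qed

lemma is_limit_law_iff:
  "is_limit_law H g \<longleftrightarrow> unit_distribution g \<and> (\<forall>x. 0 \<le> x \<and> x < 1 \<longrightarrow> measure g {0..x} = limit_cdf x)"
  by (simp add: is_limit_law_def limit_cdf_def)

lemma is_limit_law_cdf:
  assumes "is_limit_law H g"
  shows "cdf g x = (if x < 0 then 0 else if x < 1 then limit_cdf x else 1)"
proof -
  interpret g: real_distribution g
    using assms by (simp add: is_limit_law_iff unit_distribution_def)
  have full: "measure g {0..1} = 1" using assms by (simp add: is_limit_law_iff unit_distribution_def)
  have AE: "AE t in g. t \<in> {0..1}"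
    using full by (subst (asm) g.prob_eq_1) auto
  have eq: "cdf g x = measure g {0..x}"
    unfolding cdf_def by (rule g.finite_measure_eq_AE) (use AE in auto)
  consider "x < 0" | "0 \<le> x" "x < 1" | "1 \<le> x" by linarith
  then show ?thesis
  proof cases
    case 3
    then have "measure g {0..1} \<le> measure g {0..x}" by (intro g.finite_measure_mono) auto
    then have "measure g {0..x} = 1" using full g.prob_le_1[of "{0..x}"] by simp
    then show ?thesis using eq 3 by simp
  qed (use eq assms in \<open>auto simp: is_limit_law_iff\<close>)
qed

lemma is_limit_law_unique:
  assumes "is_limit_law H g" "is_limit_law H g'"
  shows "g' = g"
proof (rule cdf_unique)
  show "cdf g' = cdf g" by (rule ext) (simp add: is_limit_law_cdf assms)
qed (use assms in \<open>simp_all add: is_limit_law_iff unit_distribution_def\<close>)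

text \<open>The witness is the image of the uniform law under the monotone map \<open>\<psi>\<close>, which carries
  \<open>u\<close> in \<open>(0, pbar)\<close> to \<open>exp (- rate H u)\<close> and larger \<open>u\<close> to \<open>1\<close>.  For \<open>x < 1\<close> the set
  of \<open>u\<close> in \<open>(0, 1)\<close> with \<open>\<psi> u \<le> x\<close> is an interval from \<open>0\<close> to \<open>limit_cdf x\<close>, with or without
  its right end, so its length is \<open>limit_cdf x\<close>.\<close>

lemma limit_law_exists: "\<exists>g. is_limit_law H g"
proof -
  define \<psi> where "\<psi> u = (if u \<le> 0 then 0 else if u < pbar then exp (- rate H u) else 1)" for u
  define U where "U = uniform_measure lborel {0<..<1::real}"
  have "mono \<psi>"
  proof (rule monoI)
    fix u v :: real assume "u \<le> v"
    then consider "u = v" | "u \<le> 0" | "0 < u" "u < v" by fastforce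
    then show "\<psi> u \<le> \<psi> v"
    proof cases
      case 3
      have "exp (- rate H u) \<le> 1" if "u < pbar"
        using rate_strict_antimono[of u pbar] 3 that by (simp add: rate_pbar)
      moreover have "rate H v \<le> rate H u" if "v < pbar"
        using rate_strict_antimono[of u v] 3 that by simp
      ultimately show ?thesis using 3 by (auto simp: \<psi>_def)
    qed (auto simp: \<psi>_def)
  qed
  then have [measurable]: "\<psi> \<in> borel_measurable borel" by (rule borel_measurable_mono)
  interpret U: prob_space U unfolding U_def by (rule prob_space_uniform_measure) auto
  have [simp, measurable_cong]: "sets U = sets borel" by (simp add: U_def)
  define g where "g = distr U borel \<psi>"
  have g: "measure g A = measure lborel ({0<..<1} \<inter> \<psi> -` A)" if A: "A \<in> sets borel" for A
  proof -
    have "\<psi> -` A \<in> sets borel"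
      using measurable_sets[OF \<open>\<psi> \<in> borel_measurable borel\<close> A] by simp
    then show ?thesis
      unfolding g_def using A by (subst measure_distr) (auto simp: U_def space_uniform_measure)
  qed
  have "real_distribution g" unfolding g_def by (rule U.real_distribution_distr) measurable
  moreover have "measure g {0..1} = 1"
  proof -
    have "\<psi> u \<in> {0..1}" if "0 < u" for u
      using rate_strict_antimono[of u pbar] that by (auto simp: \<psi>_def rate_pbar)
    then have "{0<..<1} \<inter> \<psi> -` {0..1} = {0<..<1}" by auto
    then show ?thesis by (simp add: g)
  qed
  moreover have "measure g {0..x} = limit_cdf x" if x: "0 \<le> x" "x < 1" for x
  proof -
    let ?S = "{0<..<1} \<inter> \<psi> -` {0..x}"
    note A = limit_cdf_range[OF x]
    have "u \<le> limit_cdf x" if "u \<in> ?S" for u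
    proof (rule ccontr)
      assume "\<not> u \<le> limit_cdf x"
      moreover have "u < pbar" "exp (- rate H u) \<le> x" "0 < u"
        using that x by (auto simp: \<psi>_def split: if_splits)
      ultimately show False using limit_cdf_lessD[OF x, of u] by simp
    qed
    then have "measure lborel ?S \<le> measure lborel {0..limit_cdf x}"
      by (intro measure_mono_fmeasurable fmeasurableI) (auto simp: emeasure_lborel_Icc_eq)
    moreover have "measure lborel {0<..<limit_cdf x} \<le> measure lborel ?S"
    proof (rule measure_mono_fmeasurable)
      show "{0<..<limit_cdf x} \<subseteq> ?S"
        using A less_limit_cdfD[OF x] mean01_bounds by (force simp: \<psi>_def)
      show "?S \<in> fmeasurable lborel"
        by (rule fmeasurableI2[of "{0..1}"]) (auto intro!: fmeasurableI)
    qed auto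
    ultimately show ?thesis using A by (simp add: g)
  qed
  ultimately show ?thesis unfolding is_limit_law_iff unit_distribution_def by blast
qed

end

section \<open>Empirical measures\<close>

lemma integral_empirical_measure:
  assumes "f \<in> borel_measurable borel"
  shows "integral\<^sup>L (empirical_measure n x) f = (\<Sum>i=1..n. f (x i)) / real n"
  unfolding empirical_measure_def using assms
  by (subst integral_distr)
     (auto simp: integral_uniform_count_measure measurable_def space_uniform_count_measure
       sets_uniform_count_measure)

lemma real_distribution_empirical_measure:
  "n \<ge> 1 \<Longrightarrow> real_distribution (empirical_measure n x)"
  unfolding empirical_measure_def
  by (intro prob_space.real_distribution_distr prob_space_uniform_count_measure)
     (auto simp: measurable_def space_uniform_count_measure sets_uniform_count_measure)

lemma cdf_empirical_measure:
  assumes "n \<ge> 1"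
  shows "cdf (empirical_measure n x) y = real (card {k \<in> {1..n}. x k \<le> y}) / real n"
proof -
  have "cdf (empirical_measure n x) y = (1 / real n) * (\<Sum>k=1..n. indicator {..y} (x k))"
    using assms by (simp add: cdf_def measure_empirical_measure measure_return)
  also have "(\<Sum>k=1..n. indicator {..y} (x k)) = real (card {k \<in> {1..n}. x k \<le> y})"
    by (simp add: indicator_def sum.If_cases Int_def)
  finally show ?thesis by simp
qed

lemma transformed_break_point_le_iff:
  assumes "\<And>i. i \<ge> 1 \<Longrightarrow> p i \<in> {0..1}" "n \<ge> 1" "0 \<le> x"
  shows "transformed_break_point (\<lambda>n k. p n) n k \<le> x \<longleftrightarrow> break_point (\<lambda>n k. p n) n k \<le> x ^ n"
proof -
  have "root n (break_point (\<lambda>n k. p n) n k) \<le> root n (x ^ n)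
      \<longleftrightarrow> break_point (\<lambda>n k. p n) n k \<le> x ^ n"
    using assms(2) by (intro real_root_le_iff) simp
  then show ?thesis
    using assms by (simp add: transformed_break_point_def real_root_power_cancel)
qed

lemma transformed_break_point_range:
  assumes "\<And>i. i \<ge> 1 \<Longrightarrow> p i \<in> {0..1}" "n \<ge> 1"
  shows "transformed_break_point (\<lambda>n k. p n) n k \<in> {0..1}"
  using break_point_range[OF assms(1)] transformed_break_point_le_iff[OF assms zero_le_one]
  by (auto simp: transformed_break_point_def intro: real_root_ge_zero)

text \<open>Weak convergence on the line tests against bounded continuous functions on the line, so \<open>f\<close>
  is extended by its boundary values; this changes neither side, as both measures live on the unit
  interval.  The level \<open>n = 0\<close>, where the empirical measure is null, is shifted away.\<close>

lemma (in mixing_distribution) empirical_average_tendsto: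
  fixes f :: "real \<Rightarrow> real"
  assumes p: "\<And>i. i \<ge> 1 \<Longrightarrow> p i \<in> {0..1}"
    and lim: "weak_conv_m (\<lambda>n. empirical_measure n p) H"
    and f: "continuous_on {0..1} f"
  shows "(\<lambda>n. (\<Sum>i=1..n. f (p i)) / real n) \<longlonglongrightarrow> (LINT t:{0..1}|H. f t)"
proof -
  define g where "g t = f (max 0 (min 1 t))" for t
  have g_cont: "continuous_on UNIV g"
    unfolding g_def by (intro continuous_on_compose2[OF f] continuous_intros) auto
  obtain B where "\<And>t. t \<in> {0..1} \<Longrightarrow> \<bar>f t\<bar> \<le> B"
    using continuous_on_unit_bounded[OF f] by blast
  then have B: "norm (g t) \<le> B" for t by (simp add: g_def)
  have "weak_conv_m (\<lambda>n. empirical_measure (Suc n) p) H"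
    using lim unfolding weak_conv_m_def weak_conv_def by (auto intro: LIMSEQ_Suc)
  then have "(\<lambda>n. integral\<^sup>L (empirical_measure (Suc n) p) g) \<longlonglongrightarrow> integral\<^sup>L H g"
    using g_cont B real_distribution_empirical_measure real_distribution_axioms
    by (intro weak_conv_imp_integral_bdd_continuous_conv)
       (auto simp: continuous_on_eq_continuous_at)
  moreover have "integral\<^sup>L (empirical_measure (Suc n) p) g = (\<Sum>i=1..Suc n. f (p i)) / real (Suc n)" for n
  proof -
    have "g (p i) = f (p i)" if "i \<in> {1..Suc n}" for i
      using p[of i] that by (simp add: g_def)
    then show ?thesis
      using g_cont by (subst integral_empirical_measure) (auto intro: borel_measurable_continuous_onI)
  qed
  ultimately have "(\<lambda>n. (\<Sum>i=1..Suc n. f (p i)) / real (Suc n)) \<longlonglongrightarrow> integral\<^sup>L H g"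
    by (simp only:)
  then have "(\<lambda>n. (\<Sum>i=1..n. f (p i)) / real n) \<longlonglongrightarrow> integral\<^sup>L H g"
    by (rule LIMSEQ_imp_Suc)
  also have "integral\<^sup>L H g = (LINT t:{0..1}|H. f t)"
    unfolding set_lebesgue_integral_def
  proof (rule integral_cong_AE)
    show "AE t in H. g t = indicator {0..1} t *\<^sub>R f t"
      using AE_unit by (rule AE_mp) (auto simp: g_def)
    show "g \<in> borel_measurable H"
      using borel_measurable_continuous_onI[OF g_cont] by simp
    show "(\<lambda>t. indicator {0..1} t *\<^sub>R f t) \<in> borel_measurable H"
      using borel_measurable_continuous_on_indicator[OF _ f] by simp
  qed
  finally show ?thesis .
qed

section \<open>Large deviations of the break points and weak convergence\<close>

context atomless_at_1_mixing_distribution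
begin

context
  fixes p :: "nat \<Rightarrow> real"
  assumes p: "\<And>i. i \<ge> 1 \<Longrightarrow> p i \<in> {0..1}"
    and lim: "weak_conv_m (\<lambda>n. empirical_measure n p) H"
begin

abbreviation "log_mgf \<theta> n \<equiv> \<Sum>i=1..n. ln (1 - p i + p i * exp \<theta>)"

lemma log_mgf_tendsto: "(\<lambda>n. log_mgf \<theta> n / real n) \<longlonglongrightarrow> cumulant H \<theta>"
  unfolding cumulant_def by (intro empirical_average_tendsto p lim continuous_on_cumulant_integrand)

text \<open>For \<open>k \<le> \<alpha> n\<close> the exponent in Chernoff's bound at \<open>\<theta>(\<alpha>)\<close> is at most
  \<open>n (- rate H \<alpha> + o(1))\<close>.\<close>

lemma break_points_eventually_small:
  assumes \<alpha>: "\<alpha> \<in> {0<..<pbar}" and x: "exp (- rate H \<alpha>) < x"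
  shows "\<forall>\<^sub>F n in sequentially. \<forall>k. real k \<le> \<alpha> * real n \<longrightarrow> break_point (\<lambda>n k. p n) n k \<le> x ^ n"
proof -
  define \<theta> where "\<theta> = tilt H \<alpha>"
  have \<theta>: "\<theta> < 0" unfolding \<theta>_def by (rule tilt_neg[OF \<alpha>])
  have "0 < x" using x by (rule less_trans[OF exp_gt_zero])
  have "- rate H \<alpha> < ln x" using ln_less_cancel_iff[of "exp (- rate H \<alpha>)" x] x \<open>0 < x\<close> by simp
  moreover have "(\<lambda>n. - \<theta> * \<alpha> + log_mgf \<theta> n / real n) \<longlonglongrightarrow> - \<theta> * \<alpha> + cumulant H \<theta>"
    by (intro tendsto_intros log_mgf_tendsto)
  ultimately have "\<forall>\<^sub>F n in sequentially. - \<theta> * \<alpha> + log_mgf \<theta> n / real n < ln x"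
    by (intro order_tendstoD(2)) (auto simp: rate_eq \<theta>_def mult.commute)
  then show ?thesis
    using eventually_gt_at_top[of 0]
  proof eventually_elim
    case (elim n)
    show ?case
    proof (intro allI impI)
      fix k assume k: "real k \<le> \<alpha> * real n"
      have "break_point (\<lambda>n k. p n) n k \<le> exp (- \<theta> * real k + log_mgf \<theta> n)"
        using \<theta> by (intro break_point_chernoff p) auto
      also have "- \<theta> * real k + log_mgf \<theta> n \<le> - \<theta> * (\<alpha> * real n) + log_mgf \<theta> n"
        using k \<theta> by (intro add_right_mono mult_left_mono) auto
      also have "\<dots> = real n * (- \<theta> * \<alpha> + log_mgf \<theta> n / real n)"
        using elim by (simp add: field_simps)
      also have "\<dots> \<le> real n * ln x"
        using elim by (intro mult_left_mono) auto
      also have "exp (real n * ln x) = x ^ n"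
        using \<open>0 < x\<close> by (simp add: exp_of_nat_mult)
      finally show "break_point (\<lambda>n k. p n) n k \<le> x ^ n" by simp
    qed
  qed
qed

text \<open>Tilting by \<open>\<theta>(\<alpha>)\<close> moves the mean of the sum to \<open>\<alpha> n + o(n)\<close>, so a window of radius
  \<open>\<epsilon> n / 2\<close> around that mean lies below \<open>(\<alpha> + \<delta>) n\<close> as soon as \<open>\<epsilon> \<le> \<delta>\<close>, and it eventually
  carries at least half of the tilted mass.  The width of the window lowers the exponent by at
  most \<open>- \<theta> \<epsilon> n\<close>, which is absorbed in the gap between \<open>x\<close> and \<open>exp (- rate H \<alpha>)\<close>.\<close>

lemma break_points_eventually_large:
  assumes \<alpha>: "\<alpha> \<in> {0<..<pbar}" and x: "0 \<le> x" "x < exp (- rate H \<alpha>)" and "0 < \<delta>"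
  shows "\<forall>\<^sub>F n in sequentially. \<forall>k. (\<alpha> + \<delta>) * real n < real k \<longrightarrow> x ^ n < break_point (\<lambda>n k. p n) n k"
proof -
  define \<theta> where "\<theta> = tilt H \<alpha>"
  define m where "m n = (\<Sum>i=1..n. p i * exp \<theta> / (1 - p i + p i * exp \<theta>))" for n
  have \<theta>: "\<theta> < 0" unfolding \<theta>_def by (rule tilt_neg[OF \<alpha>])
  \<comment> \<open>Replacing \<open>x\<close> by a slightly larger \<open>y > 0\<close> makes \<open>ln y\<close> meaningful also for \<open>x = 0\<close>.\<close>
  obtain y where y: "x < y" "y < exp (- rate H \<alpha>)" using dense x(2) by blast
  then have "0 < y" using x(1) by simp
  have "ln y < - rate H \<alpha>" using ln_less_cancel_iff[of y "exp (- rate H \<alpha>)"] y \<open>0 < y\<close> by simp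
  \<comment> \<open>Small enough that \<open>- \<theta> \<epsilon>\<close> uses up at most half of the gap in the exponent.\<close>
  define \<epsilon> where "\<epsilon> = min \<delta> ((- rate H \<alpha> - ln y) / (2 * - \<theta>))"
  have \<epsilon>: "0 < \<epsilon>" "\<epsilon> \<le> \<delta>"
  proof -
    have "0 < (- rate H \<alpha> - ln y) / (2 * - \<theta>)"
      by (rule divide_pos_pos) (use \<theta> \<open>ln y < - rate H \<alpha>\<close> in auto)
    then show "0 < \<epsilon>" unfolding \<epsilon>_def using \<open>0 < \<delta>\<close> by (subst min_less_iff_conj) blast
  qed (simp add: \<epsilon>_def)
  have "\<epsilon> * (2 * - \<theta>) \<le> - rate H \<alpha> - ln y"
    using \<theta> by (subst pos_le_divide_eq[symmetric]) (auto simp: \<epsilon>_def)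
  then have "ln y < - rate H \<alpha> + \<theta> * \<epsilon>"
    using \<theta> \<open>0 < \<epsilon>\<close> mult_neg_pos[of \<theta> \<epsilon>] by (simp add: algebra_simps)
  also have "\<dots> = - \<theta> * (\<alpha> - \<epsilon>) + cumulant H \<theta> + 0"
    by (simp add: rate_eq \<theta>_def algebra_simps)
  finally have "ln y < \<dots>" .
  moreover have "(\<lambda>n. - \<theta> * (\<alpha> - \<epsilon>) + log_mgf \<theta> n / real n + ln (1 / 2) / real n)
      \<longlonglongrightarrow> - \<theta> * (\<alpha> - \<epsilon>) + cumulant H \<theta> + 0"
    by (intro tendsto_intros log_mgf_tendsto lim_const_over_n)
  ultimately have "\<forall>\<^sub>F n in sequentially.
      ln y < - \<theta> * (\<alpha> - \<epsilon>) + log_mgf \<theta> n / real n + ln (1 / 2) / real n"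
    by (intro order_tendstoD(1))
  moreover have m_lim: "(\<lambda>n. m n / real n) \<longlonglongrightarrow> \<alpha>"
  proof -
    have "(\<lambda>n. m n / real n) \<longlonglongrightarrow> tilted_mean H \<theta>"
      unfolding m_def tilted_mean_def
      by (intro empirical_average_tendsto p lim continuous_on_tilt_integrand)
    then show ?thesis using tilted_mean_tilt[of \<alpha>] \<alpha> by (simp add: \<theta>_def)
  qed
  have "\<forall>\<^sub>F n in sequentially. m n / real n < \<alpha> + \<epsilon> / 2"
    "\<forall>\<^sub>F n in sequentially. \<alpha> - \<epsilon> / 2 < m n / real n"
    using \<epsilon> by (auto intro: order_tendstoD[OF m_lim])
  moreover have "\<forall>\<^sub>F n in sequentially. 1 / 2 \<le> 1 - real n / (\<epsilon> / 2 * real n)\<^sup>2"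
  proof -
    have "(\<lambda>n. 1 - real n / (\<epsilon> / 2 * real n)\<^sup>2) \<longlonglongrightarrow> 1"
      using \<epsilon> by real_asymp
    then have "\<forall>\<^sub>F n in sequentially. 1 / 2 < 1 - real n / (\<epsilon> / 2 * real n)\<^sup>2"
      by (rule order_tendstoD) simp
    then show ?thesis by (rule eventually_mono) simp
  qed
  ultimately show ?thesis
    using eventually_gt_at_top[of 0]
  proof eventually_elim
    case (elim n)
    have n: "0 < real n" using elim by simp
    show ?case
    proof (intro allI impI)
      fix k assume k: "(\<alpha> + \<delta>) * real n < real k"
      have m_upper: "m n < (\<alpha> + \<epsilon> / 2) * real n" and m_lower: "(\<alpha> - \<epsilon> / 2) * real n < m n"
        using elim n by (simp_all add: pos_divide_less_eq pos_less_divide_eq)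
      have "\<epsilon> * real n \<le> \<delta> * real n" using \<epsilon> n by (intro mult_right_mono) auto
      then have mk: "m n + \<epsilon> / 2 * real n < real k"
        using m_upper k by (simp add: algebra_simps)
      have "real n * ln y
          < real n * (- \<theta> * (\<alpha> - \<epsilon>) + log_mgf \<theta> n / real n + ln (1 / 2) / real n)"
        using elim n by (intro mult_strict_left_mono) auto
      also have "\<dots> = - \<theta> * ((\<alpha> - \<epsilon>) * real n) + log_mgf \<theta> n + ln (1 / 2)"
        using n by (simp add: field_simps)
      also have "\<dots> \<le> - \<theta> * (m n - \<epsilon> / 2 * real n) + log_mgf \<theta> n + ln (1 / 2)"
        using \<theta> m_lower by (intro add_right_mono mult_left_mono) (auto simp: algebra_simps)
      finally have "exp (real n * ln y)
          < exp (- \<theta> * (m n - \<epsilon> / 2 * real n) + log_mgf \<theta> n + ln (1 / 2))" by simp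
      then have "y ^ n < 1 / 2 * exp (- \<theta> * (m n - \<epsilon> / 2 * real n) + log_mgf \<theta> n)"
        using \<open>0 < y\<close> by (simp add: exp_of_nat_mult exp_add)
      also have "\<dots> \<le> (1 - real n / (\<epsilon> / 2 * real n)\<^sup>2)
          * exp (- \<theta> * (m n - \<epsilon> / 2 * real n) + log_mgf \<theta> n)"
        using elim by (intro mult_right_mono) auto
      also have "\<dots> \<le> break_point (\<lambda>n k. p n) n k"
        unfolding m_def using \<theta> \<epsilon> n mk
        by (intro break_point_tilting_lower_bound p) (auto simp: m_def)
      finally have "y ^ n < break_point (\<lambda>n k. p n) n k" .
      moreover have "x ^ n \<le> y ^ n" using x y by (intro power_mono) auto
      ultimately show "x ^ n < break_point (\<lambda>n k. p n) n k" by simp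
    qed
  qed
qed

text \<open>The counted indices eventually contain all \<open>k \<le> \<alpha> n\<close> if \<open>\<alpha> < limit_cdf x\<close>, and none above
  \<open>(\<alpha> + \<delta>) n\<close> if \<open>\<alpha> > limit_cdf x\<close>; so in the limit the proportion
  lies between any two numbers that enclose \<open>limit_cdf x\<close>.\<close>

lemma cdf_transformed_break_points_tendsto:
  assumes x: "0 \<le> x" "x < 1"
  shows "(\<lambda>n. cdf (empirical_measure n (transformed_break_point (\<lambda>n k. p n) n)) x) \<longlonglongrightarrow> limit_cdf x"
proof -
  define N where "N n = {k \<in> {1..n}. break_point (\<lambda>n k. p n) n k \<le> x ^ n}" for n
  have cdf_eq: "cdf (empirical_measure n (transformed_break_point (\<lambda>n k. p n) n)) x = card (N n) / real n"
    if "n \<ge> 1" for n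
    using that by (simp add: cdf_empirical_measure transformed_break_point_le_iff[OF p that x(1)] N_def)
  note A = limit_cdf_range[OF x]
  have "(\<lambda>n. card (N n) / real n) \<longlonglongrightarrow> limit_cdf x"
  proof (rule order_tendstoI)
    fix a assume a: "a < limit_cdf x"
    show "\<forall>\<^sub>F n in sequentially. a < card (N n) / real n"
    proof (cases "a < 0")
      case True
      then have "a < card (N n) / real n" for n by (rule less_le_trans) simp
      then show ?thesis by simp
    next
      case False
      obtain \<alpha> where \<alpha>: "a < \<alpha>" "\<alpha> < limit_cdf x" using dense a by blast
      then have \<alpha>': "\<alpha> \<in> {0<..<pbar}" using A False by auto
      have "(\<lambda>n. \<alpha> - 1 / real n) \<longlonglongrightarrow> \<alpha> - 0"
        by (intro tendsto_intros lim_const_over_n)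
      then have "\<forall>\<^sub>F n in sequentially. a < \<alpha> - 1 / real n"
        by (rule order_tendstoD(1)) (use \<alpha> in simp)
      with break_points_eventually_small[OF \<alpha>' less_limit_cdfD[OF x \<alpha>' \<alpha>(2)]]
      show ?thesis using eventually_gt_at_top[of 0]
      proof eventually_elim
        case (elim n)
        have "\<alpha> * real n \<le> 1 * real n" using \<alpha>' mean01_bounds by (intro mult_right_mono) auto
        then have "nat \<lfloor>\<alpha> * real n\<rfloor> \<le> n" by linarith
        moreover have "real k \<le> \<alpha> * real n" if "k \<le> nat \<lfloor>\<alpha> * real n\<rfloor>" for k
          using that \<alpha>' by (simp add: le_nat_iff le_floor_iff)
        ultimately have "{1..nat \<lfloor>\<alpha> * real n\<rfloor>} \<subseteq> N n"
          using elim by (auto simp: N_def)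
        then have "card {1..nat \<lfloor>\<alpha> * real n\<rfloor>} \<le> card (N n)"
          by (intro card_mono) (auto simp: N_def)
        then have "\<alpha> * real n - 1 \<le> card (N n)" by simp linarith
        then have "(\<alpha> * real n - 1) / real n \<le> card (N n) / real n"
          by (intro divide_right_mono) auto
        then show ?case using elim by (simp add: diff_divide_distrib)
      qed
    qed
  next
    fix b assume b: "limit_cdf x < b"
    then have "limit_cdf x < min b pbar" using A by simp
    then obtain \<alpha> where \<alpha>: "limit_cdf x < \<alpha>" "\<alpha> < min b pbar" using dense by blast
    then have \<alpha>': "\<alpha> \<in> {0<..<pbar}" using A by auto
    define \<delta> where "\<delta> = (b - \<alpha>) / 2"
    have \<delta>: "0 < \<delta>" "\<alpha> + \<delta> < b" using \<alpha> by (auto simp: \<delta>_def field_simps)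
    from break_points_eventually_large[OF \<alpha>' x(1) limit_cdf_lessD[OF x \<alpha>' \<alpha>(1)] \<delta>(1)]
    show "\<forall>\<^sub>F n in sequentially. card (N n) / real n < b"
      using eventually_gt_at_top[of 0]
    proof eventually_elim
      case (elim n)
      have "k \<le> nat \<lfloor>(\<alpha> + \<delta>) * real n\<rfloor>" if "k \<in> N n" for k
      proof -
        have "real k \<le> (\<alpha> + \<delta>) * real n"
          using elim(1) that by (force simp: N_def not_less[symmetric])
        then show ?thesis by (simp add: le_nat_floor)
      qed
      then have "N n \<subseteq> {1..nat \<lfloor>(\<alpha> + \<delta>) * real n\<rfloor>}" by (auto simp: N_def)
      then have "card (N n) \<le> nat \<lfloor>(\<alpha> + \<delta>) * real n\<rfloor>"
        using card_mono[of "{1..nat \<lfloor>(\<alpha> + \<delta>) * real n\<rfloor>}" "N n"] by simp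
      moreover have "0 \<le> (\<alpha> + \<delta>) * real n" using \<alpha>' \<delta> by simp
      ultimately have "card (N n) \<le> (\<alpha> + \<delta>) * real n" by linarith
      also have "\<dots> < b * real n" using elim \<delta> by (intro mult_strict_right_mono) auto
      finally show ?case using elim by (simp add: pos_divide_less_eq)
    qed
  qed
  moreover have "\<forall>\<^sub>F n in sequentially. card (N n) / real n
      = cdf (empirical_measure n (transformed_break_point (\<lambda>n k. p n) n)) x"
    using eventually_ge_at_top[of 1] by eventually_elim (simp add: cdf_eq)
  ultimately show ?thesis by (rule Lim_transform_eventually)
qed

lemma transformed_break_points_weak_conv:
  assumes g: "is_limit_law H g"
  shows "weak_conv_m (\<lambda>n. empirical_measure n (transformed_break_point (\<lambda>n k. p n) n)) g"
  unfolding weak_conv_m_def weak_conv_def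
proof (intro allI impI)
  fix x
  let ?F = "\<lambda>n. cdf (empirical_measure n (transformed_break_point (\<lambda>n k. p n) n)) x"
  have range: "transformed_break_point (\<lambda>n k. p n) n k \<in> {0..1}" if "n \<ge> 1" for n k
    by (rule transformed_break_point_range[where p = p, OF p that])
  consider "x < 0" | "0 \<le> x" "x < 1" | "1 \<le> x" by linarith
  then show "?F \<longlonglongrightarrow> cdf g x"
  proof cases
    case 1
    have "?F n = 0" if "n \<ge> 1" for n
    proof -
      have "\<not> transformed_break_point (\<lambda>n k. p n) n k \<le> x" for k
        using range[OF that, of k] 1 by simp
      then show ?thesis using that by (simp add: cdf_empirical_measure)
    qed
    then have "\<forall>\<^sub>F n in sequentially. ?F n = 0" by (auto simp: eventually_at_top_linorder)
    then show ?thesis using 1 by (simp add: is_limit_law_cdf[OF g] tendsto_eventually)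
  next
    case 2
    then show ?thesis
      using cdf_transformed_break_points_tendsto by (simp add: is_limit_law_cdf[OF g])
  next
    case 3
    have "?F n = 1" if "n \<ge> 1" for n
    proof -
      have "transformed_break_point (\<lambda>n k. p n) n k \<le> x" for k
        using range[OF that, of k] 3 by simp
      then have "{k \<in> {1..n}. transformed_break_point (\<lambda>n k. p n) n k \<le> x} = {1..n}" by auto
      then show ?thesis using that by (simp add: cdf_empirical_measure)
    qed
    then have "\<forall>\<^sub>F n in sequentially. ?F n = 1" by (auto simp: eventually_at_top_linorder)
    then show ?thesis using 3 by (simp add: is_limit_law_cdf[OF g] tendsto_eventually)
  qed
qed

end

end

theorem theorem4p9:
  fixes p :: "nat \<Rightarrow> real" and H :: "real measure"
  assumes p_range: "\<And>n. n \<ge> 1 \<Longrightarrow> p n \<in> {0..1}"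
    and H_prob: "unit_distribution H"
    and H_nondeg: "measure H {0, 1} < 1"
    and H_lim: "weak_conv_m (\<lambda>n. empirical_measure n p) H"
  shows "mean01 H \<in> {0<..<1} \<and>
    (measure H {1} = 0 \<longrightarrow>
      (\<forall>\<alpha>\<in>{0<..<mean01 H}. \<exists>!\<theta>. tilted_mean H \<theta> = \<alpha>) \<and>
      continuous_on {0<..<mean01 H} (rate H) \<and>
      strict_antimono_on {0<..<mean01 H} (rate H) \<and>
      (rate H \<longlongrightarrow> 0) (at_left (mean01 H)) \<and>
      ((\<lambda>\<alpha>. ereal (rate H \<alpha>)) \<longlongrightarrow> ext_rate H 0) (at_right 0) \<and>
      0 < ext_rate H 0 \<and>
      x_star H \<in> {0..<1} \<and>
      (\<forall>x\<in>{x_star H..1}. \<exists>!\<alpha>. \<alpha> \<in> {0..mean01 H} \<and> ext_rate H \<alpha> = log_inverse x) \<and>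
      (\<exists>g. is_limit_law H g \<and>
           (\<forall>g'. is_limit_law H g' \<longrightarrow> g' = g) \<and>
           weak_conv_m (\<lambda>n. empirical_measure n (transformed_break_point (\<lambda>n k. p n) n)) g))"
proof -
  interpret mixing_distribution H
    using H_prob H_nondeg
    by (simp add: mixing_distribution_def mixing_distribution_axioms_def unit_distribution_def)
  show ?thesis
  proof (intro conjI impI)
    show "mean01 H \<in> {0<..<1}" using mean01_bounds by simp
  next
    assume "measure H {1} = 0"
    then interpret atomless_at_1_mixing_distribution H by unfold_locales
    obtain g where g: "is_limit_law H g" using limit_law_exists by blast
    show "\<forall>\<alpha>\<in>{0<..<mean01 H}. \<exists>!\<theta>. tilted_mean H \<theta> = \<alpha>"
      using tilt_exists_unique by simp
    show "continuous_on {0<..<mean01 H} (rate H)"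
      by (rule continuous_on_subset[OF continuous_on_rate]) auto
    show "strict_antimono_on {0<..<mean01 H} (rate H)"
      using rate_strict_antimono by (auto intro!: monotone_onI)
    show "(rate H \<longlongrightarrow> 0) (at_left (mean01 H))" by (rule rate_tendsto_0)
    show "((\<lambda>\<alpha>. ereal (rate H \<alpha>)) \<longlongrightarrow> ext_rate H 0) (at_right 0)"
      unfolding ext_rate_0 by (rule rate_tendsto_SUP)
    show "0 < ext_rate H 0" by (rule ext_rate_0_pos)
    show "x_star H \<in> {0..<1}" by (rule x_star_range)
    show "\<forall>x\<in>{x_star H..1}. \<exists>!\<alpha>. \<alpha> \<in> {0..mean01 H} \<and> ext_rate H \<alpha> = log_inverse x"
      using alpha_I_ex1 by blast
    show "\<exists>g. is_limit_law H g \<and> (\<forall>g'. is_limit_law H g' \<longrightarrow> g' = g) \<and>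
        weak_conv_m (\<lambda>n. empirical_measure n (transformed_break_point (\<lambda>n k. p n) n)) g"
      using g is_limit_law_unique[OF g] transformed_break_points_weak_conv[OF p_range H_lim g] by blast
  qed
qed

end
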